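(* Let $H$ be a cancellative small category. Then $H$ is permutably factorial if and only if $H$ is atomic and every atom of $H$ is prime-like.
   Context: A small category $H$ is identified with its set of morphisms (elements), with source $s(a)$ and target $t(a)$; $ab$ is defined iff $t(a)=s(b)$. $H^\times$ is the set of isomorphisms (units); $H$ is cancellative if $ab=ac$ or $ba=ca$ implies $b=c$. $a\simeq b$ (associated) if $b=\varepsilon a\eta$ with units $\varepsilon,\eta$. An atom is a non-unit $u$ such that $u=ab$ implies $a$ or $b$ is a unit; $H$ is atomic if every non-unit is a finite product of atoms. $H$ is permutably factorial if $H$ is atomic and, whenever $u_1\cdots u_k=v_1\cdots v_l$ with $k,l\in\mathbb N$ and atoms $u_i,v_j$, we have $k=l$ and there is a permutation $\sigma$ of $[1,k]$ with $u_i\simeq v_{\sigma(i)}$ for all $i$. For $a,b\in H$ write $a\mid_p b$ ("$a$ divides $b$ up to permutation") if there are $k,l\in\mathbb N_0$, units $\varepsilon,\eta$, atoms $u_1,\dots,u_k,v_1,\dots,v_l$ with $a=\varepsilon u_1\cdots u_k$, $b=\eta v_1\cdots v_l$, $k\le l$, and an injective map $\sigma:[1,k]\to[1,l]$ with $u_i\simeq v_{\sigma(i)}$ for all $i\in[1,k]$. A non-unit $q\in H$ is almost prime-like if $q\mid_p ab$ (with $a,b\in H$, $t(a)=s(b)$) implies $q\mid_p a$ or $q\mid_p b$. For an almost prime-like atom $q$ and $a\in H$, $\mathsf V_q(a)\subset\mathbb N_0$ is the set of all $n$ such that there are $k\in\mathbb N_0$ and atoms $u_1,\dots,u_k$ with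 $a\simeq u_1\cdots u_k$ and $n=|\{i\in[1,k]:u_i\simeq q\}|$ (in particular $\mathsf V_q(a)=\{0\}$ for $a\in H^\times$). An almost prime-like atom $q$ is prime-like if $|\mathsf V_q(a)|=1$ for all $a\in H$. *)

theory Defs
  imports Main "HOL-Combinatorics.Permutations"
begin

record ('o, 'm) category =
  Obj :: "'o set"
  Mor :: "'m set"
  src :: "'m \<Rightarrow> 'o"
  tgt :: "'m \<Rightarrow> 'o"
  ide :: "'o \<Rightarrow> 'm"
  mult :: "'m \<Rightarrow> 'm \<Rightarrow> 'm" (infixl "\<cdot>\<index>" 70)

text \<open>Products are written in diagram order: \<open>a \<cdot>\<^bsub>H\<^esub> b\<close> is meaningful for morphisms with
  \<open>tgt H a = src H b\<close>; since HOL is total, this condition is always stated explicitly.\<close>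

locale small_category =
  fixes H :: "('o, 'm, 'z) category_scheme" (structure)
  assumes src_closed: "a \<in> Mor H \<Longrightarrow> src H a \<in> Obj H"
    and tgt_closed: "a \<in> Mor H \<Longrightarrow> tgt H a \<in> Obj H"
    and ide_closed: "e \<in> Obj H \<Longrightarrow> ide H e \<in> Mor H"
    and src_ide: "e \<in> Obj H \<Longrightarrow> src H (ide H e) = e"
    and tgt_ide: "e \<in> Obj H \<Longrightarrow> tgt H (ide H e) = e"
    and mult_closed: "\<lbrakk>a \<in> Mor H; b \<in> Mor H; tgt H a = src H b\<rbrakk> \<Longrightarrow> a \<cdot> b \<in> Mor H"
    and src_mult: "\<lbrakk>a \<in> Mor H; b \<in> Mor H; tgt H a = src H b\<rbrakk> \<Longrightarrow> src H (a \<cdot> b) = src H a"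
    and tgt_mult: "\<lbrakk>a \<in> Mor H; b \<in> Mor H; tgt H a = src H b\<rbrakk> \<Longrightarrow> tgt H (a \<cdot> b) = tgt H b"
    and mult_assoc: "\<lbrakk>a \<in> Mor H; b \<in> Mor H; c \<in> Mor H; tgt H a = src H b; tgt H b = src H c\<rbrakk>
      \<Longrightarrow> (a \<cdot> b) \<cdot> c = a \<cdot> (b \<cdot> c)"
    and ide_left: "a \<in> Mor H \<Longrightarrow> ide H (src H a) \<cdot> a = a"
    and ide_right: "a \<in> Mor H \<Longrightarrow> a \<cdot> ide H (tgt H a) = a"

definition cancellative :: "('o, 'm, 'z) category_scheme \<Rightarrow> bool" where
  "cancellative H \<longleftrightarrow>
    (\<forall>a\<in>Mor H. \<forall>b\<in>Mor H. \<forall>c\<in>Mor H.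
      (tgt H a = src H b \<and> tgt H a = src H c \<and> a \<cdot>\<^bsub>H\<^esub> b = a \<cdot>\<^bsub>H\<^esub> c \<longrightarrow> b = c) \<and>
      (tgt H b = src H a \<and> tgt H c = src H a \<and> b \<cdot>\<^bsub>H\<^esub> a = c \<cdot>\<^bsub>H\<^esub> a \<longrightarrow> b = c))"

definition isos :: "('o, 'm, 'z) category_scheme \<Rightarrow> 'm set" where
  "isos H = {a \<in> Mor H. \<exists>b\<in>Mor H. tgt H a = src H b \<and> tgt H b = src H a \<and>
    a \<cdot>\<^bsub>H\<^esub> b = ide H (src H a) \<and> b \<cdot>\<^bsub>H\<^esub> a = ide H (tgt H a)}"

definition associates :: "('o, 'm, 'z) category_scheme \<Rightarrow> 'm \<Rightarrow> 'm \<Rightarrow> bool" where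
  "associates H a b \<longleftrightarrow> a \<in> Mor H \<and> b \<in> Mor H \<and>
    (\<exists>\<epsilon>\<in>isos H. \<exists>\<eta>\<in>isos H. tgt H \<epsilon> = src H a \<and> tgt H a = src H \<eta> \<and>
      b = \<epsilon> \<cdot>\<^bsub>H\<^esub> a \<cdot>\<^bsub>H\<^esub> \<eta>)"

definition atoms :: "('o, 'm, 'z) category_scheme \<Rightarrow> 'm set" where
  "atoms H = {u \<in> Mor H. u \<notin> isos H \<and>
    (\<forall>a\<in>Mor H. \<forall>b\<in>Mor H. tgt H a = src H b \<and> u = a \<cdot>\<^bsub>H\<^esub> b \<longrightarrow> a \<in> isos H \<or> b \<in> isos H)}"

text \<open>A list of morphisms that is composable starting from the object \<open>e\<close>, and its product. The
  starting object is carried along so that the empty product is the identity of \<open>e\<close>; for a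
  nonempty composable list it is necessarily the source of the first morphism.\<close>

primrec composable :: "('o, 'm, 'z) category_scheme \<Rightarrow> 'o \<Rightarrow> 'm list \<Rightarrow> bool" where
  "composable H e [] \<longleftrightarrow> e \<in> Obj H"
| "composable H e (u # us) \<longleftrightarrow> u \<in> Mor H \<and> src H u = e \<and> composable H (tgt H u) us"

primrec list_mult :: "('o, 'm, 'z) category_scheme \<Rightarrow> 'o \<Rightarrow> 'm list \<Rightarrow> 'm" where
  "list_mult H e [] = ide H e"
| "list_mult H e (u # us) = u \<cdot>\<^bsub>H\<^esub> list_mult H (tgt H u) us"

definition atomic :: "('o, 'm, 'z) category_scheme \<Rightarrow> bool" where
  "atomic H \<longleftrightarrow> (\<forall>a\<in>Mor H - isos H. \<exists>e us. us \<noteq> [] \<and> set us \<subseteq> atoms H \<and>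
    composable H e us \<and> a = list_mult H e us)"

definition permutably_factorial :: "('o, 'm, 'z) category_scheme \<Rightarrow> bool" where
  "permutably_factorial H \<longleftrightarrow> atomic H \<and>
    (\<forall>e f us vs. us \<noteq> [] \<and> vs \<noteq> [] \<and> set us \<subseteq> atoms H \<and> set vs \<subseteq> atoms H \<and>
      composable H e us \<and> composable H f vs \<and> list_mult H e us = list_mult H f vs \<longrightarrow>
      length us = length vs \<and>
      (\<exists>\<sigma>. \<sigma> permutes {..<length us} \<and>
        (\<forall>i<length us. associates H (us ! i) (vs ! \<sigma> i))))"

definition divides_up_to_perm :: "('o, 'm, 'z) category_scheme \<Rightarrow> 'm \<Rightarrow> 'm \<Rightarrow> bool" where
  "divides_up_to_perm H a b \<longleftrightarrow> a \<in> Mor H \<and> b \<in> Mor H \<and>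
    (\<exists>\<epsilon>\<in>isos H. \<exists>\<eta>\<in>isos H. \<exists>us vs. set us \<subseteq> atoms H \<and> set vs \<subseteq> atoms H \<and>
      composable H (tgt H \<epsilon>) us \<and> a = \<epsilon> \<cdot>\<^bsub>H\<^esub> list_mult H (tgt H \<epsilon>) us \<and>
      composable H (tgt H \<eta>) vs \<and> b = \<eta> \<cdot>\<^bsub>H\<^esub> list_mult H (tgt H \<eta>) vs \<and>
      length us \<le> length vs \<and>
      (\<exists>\<sigma>. inj_on \<sigma> {..<length us} \<and> \<sigma> ` {..<length us} \<subseteq> {..<length vs} \<and>
        (\<forall>i<length us. associates H (us ! i) (vs ! \<sigma> i))))"

definition almost_prime_like :: "('o, 'm, 'z) category_scheme \<Rightarrow> 'm \<Rightarrow> bool" where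
  "almost_prime_like H q \<longleftrightarrow> q \<in> Mor H \<and> q \<notin> isos H \<and>
    (\<forall>a\<in>Mor H. \<forall>b\<in>Mor H. tgt H a = src H b \<and> divides_up_to_perm H q (a \<cdot>\<^bsub>H\<^esub> b) \<longrightarrow>
      divides_up_to_perm H q a \<or> divides_up_to_perm H q b)"

definition valuations :: "('o, 'm, 'z) category_scheme \<Rightarrow> 'm \<Rightarrow> 'm \<Rightarrow> nat set" where
  "valuations H q a = {n. \<exists>e us. set us \<subseteq> atoms H \<and> composable H e us \<and>
    associates H a (list_mult H e us) \<and>
    n = card {i. i < length us \<and> associates H (us ! i) q}}"

definition prime_like :: "('o, 'm, 'z) category_scheme \<Rightarrow> 'm \<Rightarrow> bool" where
  "prime_like H q \<longleftrightarrow> q \<in> atoms H \<and> almost_prime_like H q \<and>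
    (\<forall>a\<in>Mor H. card (valuations H q a) = 1)"

end

theory Submission
  imports Defs
begin

text \<open>Up to order and associates, a factorization is the multiset of the associate classes of its
  atoms, and \<open>valuations H q a\<close> collects the multiplicities of the class of \<open>q\<close> over all
  factorizations of \<open>a\<close>. So \<open>H\<close> is permutably factorial iff it is atomic and these multiplicities
  are unique for all atoms. Uniqueness of multiplicities also makes them additive on
  products, because units between two factorizations can be absorbed into a neighbouring atom; this
  additivity makes every atom almost prime-like. Cancellativity enters only by making factors of
  units units.\<close>

section \<open>Units of a cancellative category\<close>

locale cancellative_category = small_category +
  assumes canc: "cancellative H"
begin

lemma cancel_left:
  assumes "a \<in> Mor H" "b \<in> Mor H" "c \<in> Mor H" "tgt H a = src H b" "tgt H a = src H c"
    and "a \<cdot> b = a \<cdot> c"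
  shows "b = c"
  using canc assms unfolding cancellative_def by blast

lemma isoD: "a \<in> isos H \<Longrightarrow> a \<in> Mor H"
  by (simp add: isos_def)

lemma iso_inverse:
  assumes "a \<in> isos H"
  obtains b where "b \<in> isos H" "tgt H a = src H b" "tgt H b = src H a"
    "a \<cdot> b = ide H (src H a)" "b \<cdot> a = ide H (tgt H a)"
proof -
  obtain b where b: "b \<in> Mor H" "tgt H a = src H b" "tgt H b = src H a"
    "a \<cdot> b = ide H (src H a)" "b \<cdot> a = ide H (tgt H a)"
    using assms unfolding isos_def by blast
  then have "b \<in> isos H"
    using assms unfolding isos_def by auto
  with b show thesis using that by blast
qed

lemma ide_iso: "e \<in> Obj H \<Longrightarrow> ide H e \<in> isos H"
  unfolding isos_def using ide_closed[of e] src_ide[of e] tgt_ide[of e] ide_left[of "ide H e"]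
  by (auto intro!: bexI[of _ "ide H e"])

lemma iso_mult:
  assumes "a \<in> isos H" "b \<in> isos H" "tgt H a = src H b"
  shows "a \<cdot> b \<in> isos H"
proof -
  obtain a' where a': "a' \<in> isos H" "tgt H a = src H a'" "tgt H a' = src H a"
    "a \<cdot> a' = ide H (src H a)" "a' \<cdot> a = ide H (tgt H a)"
    using iso_inverse[OF assms(1)] .
  obtain b' where b': "b' \<in> isos H" "tgt H b = src H b'" "tgt H b' = src H b"
    "b \<cdot> b' = ide H (src H b)" "b' \<cdot> b = ide H (tgt H b)"
    using iso_inverse[OF assms(2)] .
  note M = assms(1,2)[THEN isoD] a'(1)[THEN isoD] b'(1)[THEN isoD]
  have "(a \<cdot> b) \<cdot> (b' \<cdot> a') = a \<cdot> ((b \<cdot> b') \<cdot> a')"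
    using M assms(3) a'(2,3) b'(2,3) by (simp add: mult_assoc mult_closed src_mult tgt_mult)
  also have "\<dots> = ide H (src H a)"
    using M assms(3) a'(2,4) b'(4) ide_left[of a'] by simp
  finally have 1: "(a \<cdot> b) \<cdot> (b' \<cdot> a') = ide H (src H a)" .
  have "(b' \<cdot> a') \<cdot> (a \<cdot> b) = b' \<cdot> ((a' \<cdot> a) \<cdot> b)"
    using M assms(3) a'(2,3) b'(2,3) by (simp add: mult_assoc mult_closed src_mult tgt_mult)
  also have "\<dots> = ide H (tgt H b)"
    using M assms(3) a'(5) b'(5) ide_left[of b] by simp
  finally have 2: "(b' \<cdot> a') \<cdot> (a \<cdot> b) = ide H (tgt H b)" .
  show ?thesis
    unfolding isos_def mem_Collect_eq using 1 2 M assms(3) a'(2,3) b'(2,3)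
    by (intro conjI bexI[of _ "b' \<cdot> a'"]) (simp_all add: mult_closed src_mult tgt_mult)
qed

text \<open>If \<open>a \<cdot> c\<close> is an identity, then \<open>a \<cdot> (c \<cdot> a) = a\<close>, so \<open>c \<cdot> a\<close> is one too by cancellation.\<close>

lemma iso_if_mult_eq_ide:
  assumes "a \<in> Mor H" "c \<in> Mor H" "tgt H a = src H c" "a \<cdot> c = ide H (src H a)"
  shows "a \<in> isos H \<and> c \<in> isos H"
proof -
  \<comment> \<open>Comparing targets in \<open>a \<cdot> c = ide H (src H a)\<close> shows that
    \<open>c \<cdot> a\<close> is defined too.\<close>
  have tc: "tgt H c = src H a"
    using assms by (metis tgt_mult tgt_ide src_closed)
  have "a \<cdot> (c \<cdot> a) = a \<cdot> ide H (tgt H a)"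
    using assms tc by (metis mult_assoc ide_left ide_right)
  then have "c \<cdot> a = ide H (tgt H a)"
    using assms(1-3) tc cancel_left[of a "c \<cdot> a" "ide H (tgt H a)"] tgt_closed[OF assms(1)]
      src_ide[of "tgt H a"] ide_closed[of "tgt H a"]
    by (simp add: mult_closed src_mult)
  then show ?thesis
    unfolding isos_def using assms tc by (metis (mono_tags, lifting) mem_Collect_eq)
qed

text \<open>If \<open>u\<close> inverts \<open>a \<cdot> b\<close>, then \<open>b \<cdot> u\<close>
  is a right inverse of \<open>a\<close> and \<open>u \<cdot> a\<close> a left inverse of
  \<open>b\<close>; by cancellation a one-sided inverse suffices.\<close>

lemma iso_factors:
  assumes "a \<in> Mor H" "b \<in> Mor H" "tgt H a = src H b" "a \<cdot> b \<in> isos H"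
  shows "a \<in> isos H" "b \<in> isos H"
proof -
  obtain u where u: "u \<in> isos H" "tgt H (a \<cdot> b) = src H u" "tgt H u = src H (a \<cdot> b)"
    "(a \<cdot> b) \<cdot> u = ide H (src H (a \<cdot> b))" "u \<cdot> (a \<cdot> b) = ide H (tgt H (a \<cdot> b))"
    using iso_inverse[OF assms(4)] .
  note M = assms(1-3) isoD[OF u(1)]
  have "a \<cdot> (b \<cdot> u) = ide H (src H a)"
    using M u by (simp add: mult_assoc src_mult tgt_mult)
  then show "a \<in> isos H"
    using iso_if_mult_eq_ide[of a "b \<cdot> u"] M u by (simp add: mult_closed src_mult tgt_mult)
  have "(u \<cdot> a) \<cdot> b = ide H (src H (u \<cdot> a))"
    using M u by (simp add: mult_assoc src_mult tgt_mult)
  then show "b \<in> isos H"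
    using iso_if_mult_eq_ide[of "u \<cdot> a" b] M u by (simp add: mult_closed src_mult tgt_mult)
qed

section \<open>Associated elements\<close>

lemma associates_closed: "associates H a b \<Longrightarrow> a \<in> Mor H \<and> b \<in> Mor H"
  by (simp add: associates_def)

lemma associatesI:
  assumes "a \<in> Mor H" "\<epsilon> \<in> isos H" "\<eta> \<in> isos H" "tgt H \<epsilon> = src H a" "tgt H a = src H \<eta>"
  shows "associates H a (\<epsilon> \<cdot> a \<cdot> \<eta>)"
  unfolding associates_def using assms isoD by (auto simp: mult_closed tgt_mult)

lemma associatesE:
  assumes "associates H a b"
  obtains \<epsilon> \<eta> where "\<epsilon> \<in> isos H" "\<eta> \<in> isos H" "tgt H \<epsilon> = src H a" "tgt H a = src H \<eta>"
    "b = \<epsilon> \<cdot> a \<cdot> \<eta>"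
  using assms unfolding associates_def by blast

lemma associates_mult_iso_left:
  assumes "a \<in> Mor H" "\<epsilon> \<in> isos H" "tgt H \<epsilon> = src H a"
  shows "associates H a (\<epsilon> \<cdot> a)"
  using associatesI[OF assms(1,2) ide_iso[OF tgt_closed[OF assms(1)]] assms(3)]
    assms isoD[OF assms(2)] ide_right[of "\<epsilon> \<cdot> a"]
  by (simp add: mult_closed tgt_mult src_ide tgt_closed)

lemma associates_mult_iso_right:
  assumes "a \<in> Mor H" "\<eta> \<in> isos H" "tgt H a = src H \<eta>"
  shows "associates H a (a \<cdot> \<eta>)"
  using associatesI[OF assms(1) ide_iso[OF src_closed[OF assms(1)]] assms(2) _ assms(3)]
    assms ide_left[of a]
  by (simp add: tgt_ide src_closed)

lemma associates_refl: "a \<in> Mor H \<Longrightarrow> associates H a a"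
  using associates_mult_iso_right[of a "ide H (tgt H a)"]
  by (simp add: ide_iso tgt_closed src_ide ide_right)

lemma associates_sym:
  assumes "associates H a b"
  shows "associates H b a"
proof -
  from assms obtain \<epsilon> \<eta> where h: "\<epsilon> \<in> isos H" "\<eta> \<in> isos H" "tgt H \<epsilon> = src H a"
    "tgt H a = src H \<eta>" "b = \<epsilon> \<cdot> a \<cdot> \<eta>" by (rule associatesE)
  obtain \<epsilon>' where e: "\<epsilon>' \<in> isos H" "tgt H \<epsilon> = src H \<epsilon>'" "tgt H \<epsilon>' = src H \<epsilon>"
    "\<epsilon> \<cdot> \<epsilon>' = ide H (src H \<epsilon>)" "\<epsilon>' \<cdot> \<epsilon> = ide H (tgt H \<epsilon>)"
    using iso_inverse[OF h(1)] .
  obtain \<eta>' where n: "\<eta>' \<in> isos H" "tgt H \<eta> = src H \<eta>'" "tgt H \<eta>' = src H \<eta>"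
    "\<eta> \<cdot> \<eta>' = ide H (src H \<eta>)" "\<eta>' \<cdot> \<eta> = ide H (tgt H \<eta>)"
    using iso_inverse[OF h(2)] .
  have a: "a \<in> Mor H" and b: "b \<in> Mor H" using assms associates_closed by auto
  note M = a h(1,2)[THEN isoD] e(1)[THEN isoD] n(1)[THEN isoD]
  have "\<epsilon>' \<cdot> b \<cdot> \<eta>' = (\<epsilon>' \<cdot> \<epsilon>) \<cdot> (a \<cdot> (\<eta> \<cdot> \<eta>'))"
    unfolding h(5) using M h(3,4) e(2,3) n(2,3)
    by (simp add: mult_assoc mult_closed src_mult tgt_mult)
  also have "\<dots> = a"
    using M h(3,4) e(5) n(4) ide_left[of a] ide_right[of a] by simp
  finally have "\<epsilon>' \<cdot> b \<cdot> \<eta>' = a" .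
  moreover have "tgt H \<epsilon>' = src H b" "tgt H b = src H \<eta>'"
    unfolding h(5) using M h(3,4) e(2,3) n(2,3) by (simp_all add: mult_closed src_mult tgt_mult)
  ultimately show ?thesis
    using associatesI[OF b e(1) n(1)] by simp
qed

lemma associates_trans:
  assumes "associates H a b" "associates H b c"
  shows "associates H a c"
proof -
  from assms(1) obtain \<epsilon> \<eta> where h: "\<epsilon> \<in> isos H" "\<eta> \<in> isos H" "tgt H \<epsilon> = src H a"
    "tgt H a = src H \<eta>" "b = \<epsilon> \<cdot> a \<cdot> \<eta>" by (rule associatesE)
  from assms(2) obtain \<epsilon>' \<eta>' where k: "\<epsilon>' \<in> isos H" "\<eta>' \<in> isos H" "tgt H \<epsilon>' = src H b"
    "tgt H b = src H \<eta>'" "c = \<epsilon>' \<cdot> b \<cdot> \<eta>'" by (rule associatesE)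
  have a: "a \<in> Mor H" using assms associates_closed by auto
  note M = a h(1,2)[THEN isoD] k(1,2)[THEN isoD]
  \<comment> \<open>The composites of the units are defined because \<open>b\<close> starts where
    \<open>\<epsilon>\<close> starts and ends where \<open>\<eta>\<close> ends.\<close>
  have t: "tgt H \<epsilon>' = src H \<epsilon>" "tgt H \<eta> = src H \<eta>'"
    using k(3,4) M h(3,4) unfolding h(5) by (simp_all add: mult_closed src_mult tgt_mult)
  have "c = (\<epsilon>' \<cdot> \<epsilon>) \<cdot> a \<cdot> (\<eta> \<cdot> \<eta>')"
    unfolding k(5) h(5) using M h(3,4) t by (simp add: mult_assoc mult_closed src_mult tgt_mult)
  then show ?thesis
    using associatesI[OF a iso_mult[OF k(1) h(1)] iso_mult[OF h(2) k(2)]] M h(3,4) t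
    by (simp add: src_mult tgt_mult)
qed

text \<open>Turning the relation into equality of sets allows factorizations to be compared through
  \<open>map\<close>, \<open>mset\<close> and \<open>count\<close>. Outside \<open>Mor H\<close> the
  class is empty, hence the membership hypotheses in the criterion below.\<close>

definition assoc_class :: "'b \<Rightarrow> 'b set" where
  "assoc_class a = {b. associates H a b}"

lemma assoc_class_eq_iff:
  assumes "a \<in> Mor H" "b \<in> Mor H"
  shows "assoc_class a = assoc_class b \<longleftrightarrow> associates H a b"
  unfolding assoc_class_def
  using assms associates_refl associates_sym associates_trans by blast

lemma associates_iso:
  assumes "associates H a b" "a \<in> isos H"
  shows "b \<in> isos H"
proof -
  from assms(1) obtain \<epsilon> \<eta> where h: "\<epsilon> \<in> isos H" "\<eta> \<in> isos H" "tgt H \<epsilon> = src H a"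
    "tgt H a = src H \<eta>" "b = \<epsilon> \<cdot> a \<cdot> \<eta>" by (rule associatesE)
  then show ?thesis
    using assms(2) by (simp add: iso_mult isoD tgt_mult)
qed

section \<open>Atoms\<close>

lemma atomD: "u \<in> atoms H \<Longrightarrow> u \<in> Mor H" "u \<in> atoms H \<Longrightarrow> u \<notin> isos H"
  by (simp_all add: atoms_def)

lemma atom_mult:
  assumes "a \<cdot> b \<in> atoms H" "a \<in> Mor H" "b \<in> Mor H" "tgt H a = src H b"
  shows "a \<in> isos H \<or> b \<in> isos H"
  using assms unfolding atoms_def by blast

text \<open>With \<open>u = \<epsilon> \<cdot> v \<cdot> \<eta>\<close>, a splitting
  \<open>v = a \<cdot> b\<close> induces the splitting of \<open>u\<close> into
  \<open>\<epsilon> \<cdot> a\<close> and \<open>b \<cdot> \<eta>\<close>. One of these is a unit,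
  and factors of units are units.\<close>

lemma associates_atom:
  assumes "associates H u v" "u \<in> atoms H"
  shows "v \<in> atoms H"
proof -
  have v: "v \<in> Mor H" using assms associates_closed by auto
  have "v \<notin> isos H"
    using assms associates_sym associates_iso atomD by blast
  moreover have "a \<in> isos H \<or> b \<in> isos H"
    if ab: "a \<in> Mor H" "b \<in> Mor H" "tgt H a = src H b" "v = a \<cdot> b" for a b
  proof -
    obtain \<epsilon> \<eta> where h: "\<epsilon> \<in> isos H" "\<eta> \<in> isos H" "tgt H \<epsilon> = src H v"
      "tgt H v = src H \<eta>" "u = \<epsilon> \<cdot> v \<cdot> \<eta>"
      using associates_sym[OF assms(1)] by (rule associatesE)
    note M = h(1,2)[THEN isoD] ab(1-3)
    have t: "tgt H \<epsilon> = src H a" "tgt H b = src H \<eta>"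
      using h(3,4) ab by (simp_all add: src_mult tgt_mult)
    have "u = (\<epsilon> \<cdot> a) \<cdot> (b \<cdot> \<eta>)"
      unfolding h(5) ab(4) using M t by (simp add: mult_assoc mult_closed src_mult tgt_mult)
    then have "\<epsilon> \<cdot> a \<in> isos H \<or> b \<cdot> \<eta> \<in> isos H"
      using atom_mult[of "\<epsilon> \<cdot> a" "b \<cdot> \<eta>"] assms(2) M t
      by (simp add: mult_closed src_mult tgt_mult)
    then show ?thesis
      using iso_factors M t by blast
  qed
  ultimately show ?thesis
    using v unfolding atoms_def by blast
qed

section \<open>Products of composable lists\<close>

lemma list_mult_closed:
  assumes "composable H e us"
  shows "list_mult H e us \<in> Mor H" "src H (list_mult H e us) = e"
  using assms
  by (induction us arbitrary: e) (auto simp: ide_closed src_ide mult_closed src_mult)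

lemma list_mult_append:
  assumes "composable H e us" "composable H f vs" "tgt H (list_mult H e us) = f"
  shows "composable H e (us @ vs)"
    "list_mult H e (us @ vs) = list_mult H e us \<cdot> list_mult H f vs"
proof -
  have "composable H e (us @ vs) \<and>
    list_mult H e (us @ vs) = list_mult H e us \<cdot> list_mult H f vs"
    using assms
  proof (induction us arbitrary: e)
    case Nil
    then show ?case
      using list_mult_closed[OF assms(2)] ide_left[of "list_mult H f vs"] by (simp add: tgt_ide)
  next
    case (Cons u us)
    then show ?case
      using list_mult_closed[OF assms(2)] list_mult_closed[of "tgt H u" us]
      by (simp add: tgt_mult mult_assoc)
  qed
  then show "composable H e (us @ vs)"
    "list_mult H e (us @ vs) = list_mult H e us \<cdot> list_mult H f vs" by auto
qed

text \<open>A factor of a unit is a unit, so the first atom of the list would be one.\<close>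

lemma list_mult_not_iso:
  assumes "composable H e us" "set us \<subseteq> atoms H" "us \<noteq> []"
  shows "list_mult H e us \<notin> isos H"
proof (cases us)
  case (Cons u vs)
  then show ?thesis
    using assms iso_factors(1)[of u "list_mult H (tgt H u) vs"] atomD(2)[of u]
      list_mult_closed[of "tgt H u" vs] by auto
qed (use assms in simp)

section \<open>Factorizations up to associates\<close>

text \<open>Association instead of equality matches \<open>valuations\<close> and gives every unit,
  not only identities, the empty factorization.\<close>

definition factors :: "'b \<Rightarrow> 'b list \<Rightarrow> bool" where
  "factors a us \<longleftrightarrow> set us \<subseteq> atoms H \<and>
    (\<exists>e. composable H e us \<and> associates H a (list_mult H e us))"

lemma factors_closed: "factors a us \<Longrightarrow> a \<in> Mor H"
  unfolding factors_def using associates_closed by blast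

lemma factors_atoms: "factors a us \<Longrightarrow> set us \<subseteq> atoms H"
  unfolding factors_def by blast

lemma factorsI:
  assumes "set us \<subseteq> atoms H" "composable H e us"
  shows "factors (list_mult H e us) us"
  unfolding factors_def using assms associates_refl list_mult_closed by blast

lemma factors_associates:
  assumes "associates H a b" "factors b us"
  shows "factors a us"
  using assms associates_trans unfolding factors_def by blast

text \<open>Both being a unit and having only empty factorizations are invariant under association;
  this isolates the case in which no atom is available to absorb units.\<close>

lemma factors_iso_iff:
  assumes "factors a us"
  shows "a \<in> isos H \<longleftrightarrow> us = []"
proof -
  from assms obtain e where e: "composable H e us" "associates H a (list_mult H e us)"
    "set us \<subseteq> atoms H" unfolding factors_def by blast
  have "list_mult H e us \<in> isos H \<longleftrightarrow> us = []"
    using list_mult_not_iso[OF e(1,3)] e(1) ide_iso by auto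
  then show ?thesis
    using e(2) associates_iso associates_sym by blast
qed

text \<open>A unit times its inverse is an identity, so a unit is associated to the empty product at
  its source.\<close>

lemma factors_iso:
  assumes "a \<in> isos H"
  shows "factors a []"
proof -
  obtain b where b: "b \<in> isos H" "tgt H a = src H b" "tgt H b = src H a"
    "a \<cdot> b = ide H (src H a)" using iso_inverse[OF assms] .
  have "associates H a (ide H (src H a))"
    using associates_mult_iso_right[OF isoD[OF assms] b(1,2)] b(4) by simp
  then show ?thesis
    unfolding factors_def using src_closed isoD[OF assms] by auto
qed

text \<open>Only the last atom changes: it is replaced by its product with \<open>\<eta>\<close>,
  which is an associated atom.\<close>

lemma absorb_iso_right:
  assumes "us \<noteq> []" "set us \<subseteq> atoms H" "composable H e us" "\<eta> \<in> isos H"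
    "tgt H (list_mult H e us) = src H \<eta>"
  obtains vs where "set vs \<subseteq> atoms H" "composable H e vs"
    "list_mult H e vs = list_mult H e us \<cdot> \<eta>" "map assoc_class vs = map assoc_class us"
proof -
  have "\<exists>vs. set vs \<subseteq> atoms H \<and> composable H e vs \<and> list_mult H e vs = list_mult H e us \<cdot> \<eta> \<and>
    map assoc_class vs = map assoc_class us"
    using assms
  proof (induction us arbitrary: e rule: list_nonempty_induct)
    case (single u)
    have u: "u \<in> Mor H" "tgt H u = src H \<eta>" "src H u = e"
      using single by (auto simp: ide_right)
    have A: "associates H u (u \<cdot> \<eta>)"
      using associates_mult_iso_right[OF u(1) single(3) u(2)] .
    have M: "u \<cdot> \<eta> \<in> Mor H" "tgt H (u \<cdot> \<eta>) = tgt H \<eta>" "src H (u \<cdot> \<eta>) = e"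
      using u isoD[OF single(3)] by (auto simp: mult_closed src_mult tgt_mult)
    have "u \<cdot> \<eta> \<in> atoms H" using associates_atom[OF A] single(1) by simp
    moreover have "assoc_class (u \<cdot> \<eta>) = assoc_class u"
      using A assoc_class_eq_iff M(1) u(1) by blast
    ultimately show ?case
      using u M tgt_closed[OF M(1)] ide_right[OF M(1)] ide_right[OF u(1)]
      by (intro exI[of _ "[u \<cdot> \<eta>]"]) simp
  next
    case (cons u us)
    have c: "u \<in> Mor H" "src H u = e" "composable H (tgt H u) us" "set us \<subseteq> atoms H" "u \<in> atoms H"
      using cons.prems by auto
    note P = list_mult_closed[OF c(3)]
    have t: "tgt H (list_mult H (tgt H u) us) = src H \<eta>"
      using cons.prems(4) c(1) P by (simp add: tgt_mult)
    obtain vs where vs: "set vs \<subseteq> atoms H" "composable H (tgt H u) vs"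
      "list_mult H (tgt H u) vs = list_mult H (tgt H u) us \<cdot> \<eta>"
      "map assoc_class vs = map assoc_class us"
      using cons.IH[OF c(4,3) cons.prems(3) t] by blast
    then show ?case
      using c P t isoD[OF cons.prems(3)]
      by (intro exI[of _ "u # vs"]) (simp add: mult_assoc)
  qed
  then show thesis using that by blast
qed

text \<open>The unit on the right is absorbed into the last atom and the unit on the left into the
  first one, so a nonempty factorization up to associates becomes an equality without changing the
  sequence of classes.\<close>

lemma factors_exact:
  assumes "factors a us" "us \<noteq> []"
  obtains vs where "set vs \<subseteq> atoms H" "composable H (src H a) vs"
    "a = list_mult H (src H a) vs" "map assoc_class vs = map assoc_class us"
proof -
  from assms obtain e where e: "composable H e us" "associates H a (list_mult H e us)"
    "set us \<subseteq> atoms H" unfolding factors_def by blast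
  obtain \<epsilon> \<eta> where h: "\<epsilon> \<in> isos H" "\<eta> \<in> isos H" "tgt H \<epsilon> = src H (list_mult H e us)"
      "tgt H (list_mult H e us) = src H \<eta>" "a = \<epsilon> \<cdot> list_mult H e us \<cdot> \<eta>"
    using associates_sym[OF e(2)] by (rule associatesE)
  obtain vs where vs: "set vs \<subseteq> atoms H" "composable H e vs"
    "list_mult H e vs = list_mult H e us \<cdot> \<eta>" "map assoc_class vs = map assoc_class us"
    using absorb_iso_right[OF assms(2) e(3,1) h(2,4)] .
  have "vs \<noteq> []" using vs(4) assms(2) by auto
  then obtain v ws where v: "vs = v # ws" by (cases vs) auto
  note P = list_mult_closed[OF e(1)]
  note I = h(1,2)[THEN isoD]
  have m: "v \<in> Mor H" "src H v = e" "v \<in> atoms H" "composable H (tgt H v) ws" "set ws \<subseteq> atoms H"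
    using vs v by auto
  note W = list_mult_closed[OF m(4)]
  have te: "tgt H \<epsilon> = src H v" using h(3) P m by simp
  have aeq: "a = \<epsilon> \<cdot> list_mult H e vs"
    using h I P vs(3) by (simp add: mult_assoc)
  then have aeq': "a = (\<epsilon> \<cdot> v) \<cdot> list_mult H (tgt H v) ws"
    using v m W I te by (simp add: mult_assoc)
  have A: "associates H v (\<epsilon> \<cdot> v)"
    using associates_mult_iso_left[OF m(1) h(1) te] .
  have M: "\<epsilon> \<cdot> v \<in> Mor H" "src H (\<epsilon> \<cdot> v) = src H \<epsilon>" "tgt H (\<epsilon> \<cdot> v) = tgt H v"
    using m I te by (auto simp: mult_closed src_mult tgt_mult)
  \<comment> \<open>Absorbing \<open>\<epsilon>\<close> moves the start of the list from
    \<open>e\<close> to the source of \<open>a\<close>.\<close>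
  have sa: "src H a = src H \<epsilon>"
    unfolding aeq' using M W by (simp add: src_mult)
  have "assoc_class (\<epsilon> \<cdot> v) = assoc_class v"
    using A assoc_class_eq_iff M(1) m(1) by blast
  then have "map assoc_class (\<epsilon> \<cdot> v # ws) = map assoc_class us"
    using vs(4) v by simp
  moreover have "set (\<epsilon> \<cdot> v # ws) \<subseteq> atoms H"
    using associates_atom[OF A] m by simp
  ultimately show thesis
    using that[of "\<epsilon> \<cdot> v # ws"] M m sa aeq' by simp
qed

text \<open>Products known only up to associates need not be composable with each other, but their
  exact versions are and can be concatenated.\<close>

lemma factors_mult:
  assumes "factors a us" "factors b vs" "tgt H a = src H b"
  obtains ws where "factors (a \<cdot> b) ws" "map assoc_class ws = map assoc_class (us @ vs)"
proof -
  note M = assms(1,2)[THEN factors_closed]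
  \<comment> \<open>An empty list has no atom to absorb units. In that case its element is a unit,
    and the product is associated to the other element.\<close>
  consider "us = []" | "vs = []" | "us \<noteq> []" "vs \<noteq> []" by blast
  then show thesis
  proof cases
    case 1
    then have "associates H b (a \<cdot> b)"
      using associates_mult_iso_left[OF M(2)] factors_iso_iff[OF assms(1)] assms(3) by simp
    then show thesis
      using that[of vs] 1 factors_associates[OF associates_sym assms(2)] by simp
  next
    case 2
    then have "associates H a (a \<cdot> b)"
      using associates_mult_iso_right[OF M(1)] factors_iso_iff[OF assms(2)] assms(3) by simp
    then show thesis
      using that[of us] 2 factors_associates[OF associates_sym assms(1)] by simp
  next
    case 3
    obtain us' where us': "set us' \<subseteq> atoms H" "composable H (src H a) us'"
      "a = list_mult H (src H a) us'" "map assoc_class us' = map assoc_class us"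
      using factors_exact[OF assms(1) 3(1)] .
    obtain vs' where vs': "set vs' \<subseteq> atoms H" "composable H (src H b) vs'"
      "b = list_mult H (src H b) vs'" "map assoc_class vs' = map assoc_class vs"
      using factors_exact[OF assms(2) 3(2)] .
    have t: "tgt H (list_mult H (src H a) us') = src H b" using us'(3) assms(3) by simp
    have "factors (a \<cdot> b) (us' @ vs')"
      using factorsI[of "us' @ vs'" "src H a"] list_mult_append[OF us'(2) vs'(2) t] us' vs' by simp
    then show thesis
      using that us'(4) vs'(4) by simp
  qed
qed

lemma factors_exists:
  assumes "atomic H" "a \<in> Mor H"
  obtains us where "factors a us"
proof (cases "a \<in> isos H")
  case True
  then show thesis using that factors_iso by blast
next
  case False
  then obtain e us where "set us \<subseteq> atoms H" "composable H e us" "a = list_mult H e us"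
    using assms unfolding atomic_def by blast
  then show thesis using that factorsI by blast
qed

section \<open>Multiplicities and multisets of associate classes\<close>

lemma card_associates_eq_count:
  assumes "set us \<subseteq> atoms H" "q \<in> Mor H"
  shows "card {i. i < length us \<and> associates H (us ! i) q} =
    count (mset (map assoc_class us)) (assoc_class q)"
proof -
  \<comment> \<open>The index set is rewritten through the list of classes, with
    \<open>assoc_class q\<close> on the left of the equation, as in
    \<open>count_list_eq_length_filter\<close>.\<close>
  have "{i. i < length us \<and> associates H (us ! i) q} =
    {i. i < length (map assoc_class us) \<and> assoc_class q = map assoc_class us ! i}"
    using assms assoc_class_eq_iff atomD(1) by (auto simp: subset_iff) (metis nth_mem)+
  then show ?thesis
    by (simp only: count_mset count_list_eq_length_filter length_filter_conv_card)
qed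

lemma valuations_eq:
  assumes "q \<in> Mor H"
  shows "valuations H q a =
    {count (mset (map assoc_class us)) (assoc_class q) |us. factors a us}"
  unfolding valuations_def factors_def
  by (fastforce simp: card_associates_eq_count[OF _ assms] simp del: mset_map)

text \<open>Lists have the same multiset of entries exactly when some permutation of the indices
  turns one into the other. For lists of classes of atoms this is the permutation condition of
  \<open>permutably_factorial\<close>.\<close>

lemma assoc_permutation_iff:
  assumes "set us \<subseteq> atoms H" "set vs \<subseteq> atoms H"
  shows "mset (map assoc_class us) = mset (map assoc_class vs) \<longleftrightarrow>
    length us = length vs \<and>
    (\<exists>\<sigma>. \<sigma> permutes {..<length us} \<and> (\<forall>i<length us. associates H (us ! i) (vs ! \<sigma> i)))"
    (is "?L \<longleftrightarrow> ?R")
proof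
  have cls: "associates H (us ! i) (vs ! j) \<longleftrightarrow> assoc_class (us ! i) = assoc_class (vs ! j)"
    if "i < length us" "j < length vs" for i j
    using assoc_class_eq_iff atomD(1) assms that by (metis nth_mem subsetD)
  {
    assume L: ?L
    then have len: "length us = length vs"
      by (metis length_map mset_eq_length)
    \<comment> \<open>Position \<open>i\<close> of \<open>permute_list p\<close> holds entry
      \<open>p i\<close>, so \<open>p\<close> itself is the required
      \<open>\<sigma>\<close>.\<close>
    obtain p where p: "p permutes {..<length (map assoc_class vs)}"
      "permute_list p (map assoc_class vs) = map assoc_class us"
      using mset_eq_permutation[OF L] .
    have "associates H (us ! i) (vs ! p i)" if i: "i < length us" for i
    proof -
      have pi: "p i < length vs"
        using permutes_in_image[OF p(1), of i] i len by simp
      have "assoc_class (us ! i) = permute_list p (map assoc_class vs) ! i"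
        using p(2) i by simp
      also have "\<dots> = assoc_class (vs ! p i)"
        using permute_list_nth[OF p(1)] i len pi by simp
      finally show ?thesis using cls[OF i pi] by simp
    qed
    then show ?R using len p(1) by auto
  next
    assume ?R
    then obtain p where len: "length us = length vs" and p: "p permutes {..<length us}"
      "\<And>i. i < length us \<Longrightarrow> associates H (us ! i) (vs ! p i)" by blast
    have p': "p permutes {..<length (map assoc_class vs)}" using p(1) len by simp
    have "permute_list p (map assoc_class vs) = map assoc_class us"
    proof (rule nth_equalityI)
      fix i assume "i < length (permute_list p (map assoc_class vs))"
      then have i: "i < length us" using len by simp
      have pi: "p i < length vs"
        using permutes_in_image[OF p(1), of i] i len by simp
      show "permute_list p (map assoc_class vs) ! i = map assoc_class us ! i"
        using permute_list_nth[OF p', of i] i len pi cls[OF i pi] p(2)[OF i] by simp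
    qed (use len in simp)
    then show ?L using mset_permute_list[OF p'] by metis
  }
qed

text \<open>Exact factorizations are factorizations up to associates, and conversely
  \<open>factors_exact\<close> makes two nonempty factorizations of \<open>a\<close> exact while
  keeping their classes.\<close>

lemma permutably_factorial_iff:
  "permutably_factorial H \<longleftrightarrow> atomic H \<and>
    (\<forall>a us vs. factors a us \<and> factors a vs \<longrightarrow>
      mset (map assoc_class us) = mset (map assoc_class vs))"
    (is "?L \<longleftrightarrow> ?R")
proof
  assume L: ?L
  have "mset (map assoc_class us) = mset (map assoc_class vs)"
    if f: "factors a us" "factors a vs" for a us vs
  \<comment> \<open>The definition speaks of nonempty lists only. An empty factorization makes
    \<open>a\<close> a unit, which forces the other one to be empty as well.\<close>
  proof (cases "us = []")
    case True
    then show ?thesis using f factors_iso_iff by blast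
  next
    case False
    then have F: "vs \<noteq> []" using f factors_iso_iff by blast
    obtain us' where us': "set us' \<subseteq> atoms H" "composable H (src H a) us'"
      "a = list_mult H (src H a) us'" "map assoc_class us' = map assoc_class us"
      using factors_exact[OF f(1) False] .
    obtain vs' where vs': "set vs' \<subseteq> atoms H" "composable H (src H a) vs'"
      "a = list_mult H (src H a) vs'" "map assoc_class vs' = map assoc_class vs"
      using factors_exact[OF f(2) F] .
    have "us' \<noteq> []" "vs' \<noteq> []" using us'(4) vs'(4) False F by auto
    then have "length us' = length vs' \<and> (\<exists>\<sigma>. \<sigma> permutes {..<length us'} \<and>
        (\<forall>i<length us'. associates H (us' ! i) (vs' ! \<sigma> i)))"
      using L us'(1-3) vs'(1-3) unfolding permutably_factorial_def by metis
    then show ?thesis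
      using assoc_permutation_iff[OF us'(1) vs'(1)] us'(4) vs'(4) by metis
  qed
  then show ?R using L unfolding permutably_factorial_def by blast
next
  assume R: ?R
  have "length us = length vs \<and> (\<exists>\<sigma>. \<sigma> permutes {..<length us} \<and>
        (\<forall>i<length us. associates H (us ! i) (vs ! \<sigma> i)))"
    if "set us \<subseteq> atoms H" "set vs \<subseteq> atoms H" "composable H e us" "composable H f vs"
      "list_mult H e us = list_mult H f vs" for e f us vs
    using R factorsI[OF that(1,3)] factorsI[OF that(2,4)] that(5)
      assoc_permutation_iff[OF that(1,2)] by metis
  then show ?L using R unfolding permutably_factorial_def by blast
qed

section \<open>Divisibility up to permutation by an atom\<close>

lemma list_mult_atom:
  assumes "set us \<subseteq> atoms H" "composable H e us" "list_mult H e us \<in> atoms H"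
  obtains u where "us = [u]"
proof (cases us)
  case Nil
  then show thesis using assms ide_iso atomD(2) by auto
next
  case (Cons u vs)
  \<comment> \<open>A nonempty tail has a non-unit product, so the atom would split into two
    non-units.\<close>
  have "vs = []"
  proof (rule ccontr)
    assume "vs \<noteq> []"
    then have "list_mult H (tgt H u) vs \<notin> isos H"
      using list_mult_not_iso[of "tgt H u" vs] assms Cons by simp
    then show False
      using atom_mult[of u "list_mult H (tgt H u) vs"] assms Cons atomD(2)
        list_mult_closed[of "tgt H u" vs] by auto
  qed
  then show thesis using that Cons by simp
qed

text \<open>An atom has only one-element factorizations, so the injection between index sets merely
  picks one occurrence of its class.\<close>

lemma atom_divides_iff:
  assumes q: "q \<in> atoms H"
  shows "divides_up_to_perm H q a \<longleftrightarrow>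
    (\<exists>us. factors a us \<and> assoc_class q \<in> set (map assoc_class us))" (is "?L \<longleftrightarrow> ?R")
proof
  note qM = atomD(1)[OF q]
  {
    assume ?L
    then obtain \<epsilon> \<eta> us vs \<sigma> where h: "\<epsilon> \<in> isos H" "\<eta> \<in> isos H" "set us \<subseteq> atoms H"
      "set vs \<subseteq> atoms H" "composable H (tgt H \<epsilon>) us" "q = \<epsilon> \<cdot> list_mult H (tgt H \<epsilon>) us"
      "composable H (tgt H \<eta>) vs" "a = \<eta> \<cdot> list_mult H (tgt H \<eta>) vs"
      "\<sigma> ` {..<length us} \<subseteq> {..<length vs}"
      "\<And>i. i < length us \<Longrightarrow> associates H (us ! i) (vs ! \<sigma> i)"
      unfolding divides_up_to_perm_def by blast
    note U = list_mult_closed[OF h(5)] and V = list_mult_closed[OF h(7)]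
    have qa: "associates H (list_mult H (tgt H \<epsilon>) us) q"
      unfolding h(6) using associates_mult_iso_left[OF U(1) h(1)] U(2) by simp
    then have "list_mult H (tgt H \<epsilon>) us \<in> atoms H"
      using associates_atom associates_sym q by blast
    \<comment> \<open>The list on the side of \<open>q\<close> has an atom as its product, hence a
      single entry, and \<open>\<sigma>\<close> matters only at index \<open>0\<close>.\<close>
    then obtain u where u: "us = [u]"
      using list_mult_atom[OF h(3,5)] by blast
    have uM: "u \<in> Mor H" using h(5) u by simp
    have "associates H u q"
      using qa u uM ide_right[OF uM] by simp
    moreover have s: "\<sigma> 0 < length vs" and "associates H u (vs ! \<sigma> 0)"
      using h(9) h(10)[of 0] u by auto
    ultimately have "associates H q (vs ! \<sigma> 0)"
      using associates_sym associates_trans by blast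
    then have "assoc_class q = assoc_class (vs ! \<sigma> 0)"
      using assoc_class_eq_iff associates_closed by blast
    then have "assoc_class q \<in> set (map assoc_class vs)"
      using s by auto
    moreover have "factors a vs"
      using factors_associates[OF associates_sym factorsI[OF h(4,7)]]
        associates_mult_iso_left[OF V(1) h(2)] V(2) h(8) by simp
    ultimately show ?R by blast
  next
    assume ?R
    then obtain us where us: "factors a us" "assoc_class q \<in> set (map assoc_class us)" by blast
    have aM: "a \<in> Mor H" using factors_closed[OF us(1)] .
    have "us \<noteq> []" using us(2) by auto
    then obtain vs where vs: "set vs \<subseteq> atoms H" "composable H (src H a) vs"
      "a = list_mult H (src H a) vs" "map assoc_class vs = map assoc_class us"
      using factors_exact[OF us(1)] by blast
    then have "assoc_class q \<in> set (map assoc_class vs)" using us(2) by simp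
    then obtain i where i: "i < length vs" "assoc_class q = assoc_class (vs ! i)"
      by (auto simp: in_set_conv_nth)
    then have "associates H q (vs ! i)"
      using assoc_class_eq_iff[OF qM] vs(1) atomD(1) by (meson nth_mem subsetD)
    moreover have "ide H (src H q) \<cdot> list_mult H (src H q) [q] = q"
      using ide_left[OF qM] ide_right[OF qM] by simp
    moreover have "ide H (src H a) \<cdot> list_mult H (src H a) vs = a"
      using ide_left[OF aM] vs(3) by simp
    moreover have "tgt H (ide H (src H q)) = src H q" "tgt H (ide H (src H a)) = src H a"
      using src_closed aM qM by (simp_all add: tgt_ide)
    moreover have "composable H (src H q) [q]" using qM tgt_closed by simp
    \<comment> \<open>Identities serve as both units and \<open>[q]\<close> as the factorization of
      \<open>q\<close>. The constant map to \<open>i\<close> is injective because its domain is a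
      single index.\<close>
    ultimately show ?L
      unfolding divides_up_to_perm_def using aM qM q vs(1,2) i(1)
      by (intro conjI, simp, simp)
        (rule bexI[of _ "ide H (src H q)"], rule bexI[of _ "ide H (src H a)"],
          rule exI[of _ "[q]"], rule exI[of _ vs], intro conjI exI[where x = "\<lambda>_. i"],
          simp_all add: ide_iso src_closed lessThan_Suc)
  }
qed

section \<open>The two implications\<close>

lemma permutably_factorial_prime_like:
  assumes "permutably_factorial H" and q: "q \<in> atoms H"
  shows "prime_like H q"
proof -
  have at: "atomic H" and uniq: "\<And>a us vs. factors a us \<Longrightarrow> factors a vs \<Longrightarrow>
      mset (map assoc_class us) = mset (map assoc_class vs)"
    using assms(1) unfolding permutably_factorial_iff by blast+
  have "divides_up_to_perm H q a \<or> divides_up_to_perm H q b"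
    if ab: "a \<in> Mor H" "b \<in> Mor H" "tgt H a = src H b" "divides_up_to_perm H q (a \<cdot> b)" for a b
  proof -
    obtain us vs where uv: "factors a us" "factors b vs"
      using factors_exists[OF at] ab by metis
    \<comment> \<open>One factorization of \<open>a \<cdot> b\<close> has exactly the classes of a
      factorization of \<open>a\<close> followed by those of one of \<open>b\<close>. By uniqueness
      the class of \<open>q\<close> occurs in it, hence in one of the two halves.\<close>
    obtain ws where ws: "factors (a \<cdot> b) ws" "map assoc_class ws = map assoc_class (us @ vs)"
      using factors_mult[OF uv ab(3)] .
    obtain xs where "factors (a \<cdot> b) xs" "assoc_class q \<in> set (map assoc_class xs)"
      using ab(4) atom_divides_iff[OF q] by blast
    then have "assoc_class q \<in> set (map assoc_class ws)"
      using uniq[OF ws(1)] mset_eq_setD by metis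
    then show ?thesis
      using ws(2) uv atom_divides_iff[OF q] by auto
  qed
  then have "almost_prime_like H q"
    unfolding almost_prime_like_def using atomD q by blast
  moreover have "card (valuations H q a) = 1" if a: "a \<in> Mor H" for a
  proof -
    obtain us where us: "factors a us" using factors_exists[OF at a] .
    have "count (mset (map assoc_class vs)) C = count (mset (map assoc_class us)) C"
      if "factors a vs" for vs C
      using uniq[OF that us] by (rule arg_cong)
    then have "valuations H q a = {count (mset (map assoc_class us)) (assoc_class q)}"
      unfolding valuations_eq[OF atomD(1)[OF q]] using us by blast
    then show ?thesis by simp
  qed
  ultimately show ?thesis unfolding prime_like_def using q by blast
qed

text \<open>Multisets agree if all multiplicities do. For the class of an atom \<open>q\<close>,
  both multiplicities lie in \<open>valuations H q a\<close>, which is a singleton because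
  \<open>q\<close> is prime-like.\<close>

lemma prime_like_permutably_factorial:
  assumes "atomic H" "\<forall>q\<in>atoms H. prime_like H q"
  shows "permutably_factorial H"
proof -
  have "mset (map assoc_class us) = mset (map assoc_class vs)"
    if f: "factors a us" "factors a vs" for a us vs
  proof (rule multiset_eqI)
    fix C
    show "count (mset (map assoc_class us)) C = count (mset (map assoc_class vs)) C"
    proof (cases "C \<in> assoc_class ` atoms H")
      case True
      then obtain q where q: "q \<in> atoms H" "C = assoc_class q" by blast
      have "card (valuations H q a) = 1"
        using assms(2) q(1) factors_closed[OF f(1)] unfolding prime_like_def by blast
      then obtain n where "valuations H q a = {n}" by (rule card_1_singletonE)
      then show ?thesis
        using f unfolding q(2) valuations_eq[OF atomD(1)[OF q(1)]] set_eq_iff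
        by (metis (mono_tags, lifting) mem_Collect_eq singletonD)
    next
      case False
      \<comment> \<open>All entries are atoms, so a set that is not the class of an atom has
        multiplicity zero on both sides.\<close>
      then have "C \<notin># mset (map assoc_class us)" "C \<notin># mset (map assoc_class vs)"
        using f[THEN factors_atoms] by auto
      then show ?thesis by (simp only: not_in_iff)
    qed
  qed
  then show ?thesis using assms(1) permutably_factorial_iff by blast
qed

end

theorem proposition5p15:
  fixes H :: "('o, 'm, 'z) category_scheme"
  assumes "small_category H" and "cancellative H"
  shows "permutably_factorial H \<longleftrightarrow> atomic H \<and> (\<forall>q\<in>atoms H. prime_like H q)"
proof -
  interpret cancellative_category H
    using assms by (simp add: cancellative_category_def cancellative_category_axioms_def)
  show ?thesis
    using permutably_factorial_prime_like prime_like_permutably_factorial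
    unfolding permutably_factorial_iff by blast
qed

end
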